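(* Let $n\ge 1$. The map $G\mapsto S_G=\{N_G(i)\to N_G(i)\cup\{i\}: i\in[n]\}$ is a bijection from the set of labeled cographs on the vertex set $[n]=\{1,\dots,n\}$ to the set of minimum-cardinality diamond-generating subsets of $E(\mathcal{B}_n)$. Consequently, these two classes have the same cardinality.
   Context: Graphs are finite, simple and undirected; $N_G(i)$ denotes the open neighborhood of the vertex $i$ in $G$. Labeled graphs on $[n]$ are graphs with vertex set $[n]$, counted up to equality (not isomorphism). $\mathcal{B}_n$ is the Boolean lattice of subsets of $X=[n]$ ordered by inclusion. A cover edge is $e_i(A): A\to A\cup\{i\}$ with $i\in X$ and $A\subseteq X\setminus\{i\}$; $i$ is its direction. $E(\mathcal{B}_n)$ is the set of all cover edges. Thus $S_G=\{e_i(N_G(i)): i\in[n]\}$. A diamond is determined by $A\subseteq X$ and distinct $i,j\in X\setminus A$. Its lower half is $L(A;i,j)=\{e_i(A),e_j(A)\}$, its upper half is $U(A;i,j)=\{e_i(A\cup\{j\}),e_j(A\cup\{i\})\}$, and its four edges are $L(A;i,j)\cup U(A;i,j)$. Diamond closure: for $S\subseteq E(\mathcal{B}_n)$ let $S^{(0)}=S$ and let $S^{(t+1)}$ be $S^{(t)}$ together with all four edges of every diamond for which $L(A;i,j)\subseteq S^{(t)}$ or $U(A;i,j)\subseteq S^{(t)}$. The diamond closure of $S$ is $\bigcup_{t\ge 0}S^{(t)}$, and $S$ is diamond-generating if its diamond closure is $E(\mathcal{B}_n)$. A minimum-cardinality diamond-generating subset is one whose cardinality is smallest among all diamond-generating subsets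 (not merely inclusion-minimal). The join $G_1\vee G_2$ is obtained from the disjoint union of $G_1$ and $G_2$ by adding every edge between their vertex sets. A cograph is a graph obtained from one-vertex graphs by repeated disjoint union and join (equivalently, a graph with no induced path on four vertices). *)

theory Defs
  imports "Graph_Theory.Pair_Digraph"
begin

text \<open>
  A simple graph is a \<open>pair_graph\<close>: a finite vertex set together with a symmetric,
  loop-free set of ordered pairs, an undirected edge being present in both directions.
  Two such graphs are equal iff their vertex and edge sets are, so equality of records is
  equality of labeled graphs.
\<close>

definition nbhd :: "'a pair_pre_digraph \<Rightarrow> 'a \<Rightarrow> 'a set" where
  "nbhd G i = {j. (i, j) \<in> parcs G}"

text \<open>
  The next two operations are meant for graphs whose vertex sets are already disjoint.
\<close>

definition graph_union :: "'a pair_pre_digraph \<Rightarrow> 'a pair_pre_digraph \<Rightarrow> 'a pair_pre_digraph" where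
  "graph_union G H = \<lparr>pverts = pverts G \<union> pverts H, parcs = parcs G \<union> parcs H\<rparr>"

definition graph_join :: "'a pair_pre_digraph \<Rightarrow> 'a pair_pre_digraph \<Rightarrow> 'a pair_pre_digraph" where
  "graph_join G H = \<lparr>pverts = pverts G \<union> pverts H,
     parcs = parcs G \<union> parcs H \<union> pverts G \<times> pverts H \<union> pverts H \<times> pverts G\<rparr>"

text \<open>
  Since a one-vertex graph may carry any label, every labeled copy of a cograph is generated
  and no closure under isomorphism is needed.
\<close>

inductive cograph :: "'a pair_pre_digraph \<Rightarrow> bool" where
  single: "cograph \<lparr>pverts = {v}, parcs = {}\<rparr>"
| union: "\<lbrakk>cograph G; cograph H; pverts G \<inter> pverts H = {}\<rbrakk> \<Longrightarrow> cograph (graph_union G H)"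
| join: "\<lbrakk>cograph G; cograph H; pverts G \<inter> pverts H = {}\<rbrakk> \<Longrightarrow> cograph (graph_join G H)"

lemma cograph_imp_pair_graph: "cograph G \<Longrightarrow> pair_graph G"
proof (induction rule: cograph.induct)
  case (single v)
  show ?case
    by unfold_locales (auto simp: symmetric_def sym_def)
next
  case (union G H)
  then interpret G: pair_graph G + H: pair_graph H by simp_all
  have "sym (parcs G)" "sym (parcs H)"
    using G.pair_sym_arcs H.pair_sym_arcs by (simp_all add: symmetric_def)
  then show ?case
    by unfold_locales
      (auto simp: graph_union_def symmetric_def sym_Un
            dest: G.wellformed' H.wellformed' G.pair_no_loops H.pair_no_loops)
next
  case (join G H)
  then interpret G: pair_graph G + H: pair_graph H by simp_all
  have "sym (parcs G)" "sym (parcs H)"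
    using G.pair_sym_arcs H.pair_sym_arcs by (simp_all add: symmetric_def)
  then show ?case using join.hyps
    by unfold_locales
      (auto simp: graph_join_def symmetric_def sym_def
            dest: G.wellformed' H.wellformed' G.pair_no_loops H.pair_no_loops)
qed

definition labeled_cographs :: "nat \<Rightarrow> nat pair_pre_digraph set" where
  "labeled_cographs n = {G. pair_graph G \<and> pverts G = {1..n} \<and> cograph G}"

text \<open>
  An edge of the Hasse diagram of the Boolean lattice is the pair of its lower and upper end;
  \<open>cover_edge i A\<close> is a cover edge only if \<open>i \<notin> A\<close>.
\<close>

type_synonym bool_edge = "nat set \<times> nat set"

definition cover_edge :: "nat \<Rightarrow> nat set \<Rightarrow> bool_edge" where
  "cover_edge i A = (A, A \<union> {i})"

definition cover_edges :: "nat \<Rightarrow> bool_edge set" where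
  "cover_edges n = {cover_edge i A | i A. i \<in> {1..n} \<and> A \<subseteq> {1..n} - {i}}"

definition lower_half :: "nat set \<Rightarrow> nat \<Rightarrow> nat \<Rightarrow> bool_edge set" where
  "lower_half A i j = {cover_edge i A, cover_edge j A}"

definition upper_half :: "nat set \<Rightarrow> nat \<Rightarrow> nat \<Rightarrow> bool_edge set" where
  "upper_half A i j = {cover_edge i (A \<union> {j}), cover_edge j (A \<union> {i})}"

definition is_diamond :: "nat \<Rightarrow> nat set \<Rightarrow> nat \<Rightarrow> nat \<Rightarrow> bool" where
  "is_diamond n A i j \<longleftrightarrow> A \<subseteq> {1..n} \<and> i \<in> {1..n} - A \<and> j \<in> {1..n} - A \<and> i \<noteq> j"

definition diamond_step :: "nat \<Rightarrow> bool_edge set \<Rightarrow> bool_edge set" where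
  "diamond_step n S = S \<union> \<Union> {lower_half A i j \<union> upper_half A i j | A i j.
     is_diamond n A i j \<and> (lower_half A i j \<subseteq> S \<or> upper_half A i j \<subseteq> S)}"

definition diamond_closure :: "nat \<Rightarrow> bool_edge set \<Rightarrow> bool_edge set" where
  "diamond_closure n S = (\<Union>t. (diamond_step n ^^ t) S)"

definition diamond_generating :: "nat \<Rightarrow> bool_edge set \<Rightarrow> bool" where
  "diamond_generating n S \<longleftrightarrow> S \<subseteq> cover_edges n \<and> diamond_closure n S = cover_edges n"

definition min_diamond_generating :: "nat \<Rightarrow> bool_edge set set" where
  "min_diamond_generating n = {S. is_arg_min card (diamond_generating n) S}"

definition graph_edges :: "nat pair_pre_digraph \<Rightarrow> bool_edge set" where
  "graph_edges G = {cover_edge i (nbhd G i) | i. i \<in> pverts G}"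

end

theory Submission
  imports Defs "HOL-Library.Disjoint_Sets"
begin

text \<open>
  Why the theorem holds. A diamond carries exactly two directions, and each of its halves already
  contains both; so no direction is ever created, a generating set has an edge in every one of the
  \<open>n\<close> directions (\<open>generating_has_direction\<close>), and a generating set of size \<open>n\<close> is a choice
  of one edge \<open>e\<^sub>i(f i)\<close> per direction.

  For a cograph the edges \<open>e\<^sub>i(N(i))\<close> generate. The induction follows the construction of the
  cograph and proves slightly more: a copy of the edges shifted by a set \<open>C\<close> outside the vertex
  set generates the whole subcube with bottom \<open>C\<close> (\<open>cograph_generates_cube\<close>). A disjoint union
  supplies two subcubes with common bottom, a join two subcubes with common top; and all edges of
  a cube follow from those at its bottom by lower halves, or from those at its top by upper halves.

  Conversely, let one edge \<open>e\<^sub>i(f i)\<close> per direction generate. Looking only at the two coordinates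
  \<open>i\<close> and \<open>j\<close> shows that \<open>f\<close> is symmetric (\<open>generating_symmetric\<close>), so \<open>f\<close> is the neighborhood
  function of a graph. Partition its vertices into as few modules as possible, each inducing a
  cograph; a module \<open>V\<close> spans a subcube whose bottom is its common outside neighborhood. The edges
  in these subcubes include all \<open>e\<^sub>i(f i)\<close>. With at least two modules they are not all cover
  edges, so some diamond with a half among them sticks out. Its two directions lie in different
  modules, and the half forces these modules to have equal neighborhoods elsewhere. Since disjoint
  modules are completely adjacent or completely nonadjacent, their join or disjoint union is
  a larger cograph module, against minimality. So there is a single module and the graph is a
  cograph.
\<close>

section \<open>Diamond-closed predicates on cover edges\<close>

text \<open>
  A set of cover edges is handled as a predicate \<open>R i A\<close> on directions and lower ends. Being
  closed under both kinds of diamond steps then becomes a single equivalence per diamond.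
\<close>

definition diamond_closed :: "nat \<Rightarrow> (nat \<Rightarrow> nat set \<Rightarrow> bool) \<Rightarrow> bool" where
  "diamond_closed n R \<longleftrightarrow> (\<forall>A i j. is_diamond n A i j \<longrightarrow>
     (R i A \<and> R j A \<longleftrightarrow> R i (insert j A) \<and> R j (insert i A)))"

lemma diamond_closedD:
  assumes "diamond_closed n R" "A \<subseteq> {1..n}" "i \<in> {1..n}" "j \<in> {1..n}" "i \<notin> A" "j \<notin> A" "i \<noteq> j"
  shows "R i A \<and> R j A \<longleftrightarrow> R i (insert j A) \<and> R j (insert i A)"
  using assms by (auto simp: diamond_closed_def is_diamond_def)

lemma cover_edge_inject:
  assumes "i \<notin> A" "j \<notin> B"
  shows "cover_edge i A = cover_edge j B \<longleftrightarrow> i = j \<and> A = B"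
  using assms by (auto simp: cover_edge_def)

lemma cover_edge_in_cover_edges:
  assumes "i \<notin> A"
  shows "cover_edge i A \<in> cover_edges n \<longleftrightarrow> i \<in> {1..n} \<and> A \<subseteq> {1..n}"
proof
  assume "cover_edge i A \<in> cover_edges n"
  then obtain j B where "cover_edge i A = cover_edge j B" "j \<in> {1..n}" "B \<subseteq> {1..n} - {j}"
    by (auto simp: cover_edges_def)
  moreover from this have "i = j \<and> A = B"
    using assms cover_edge_inject[of i A j B] by auto
  ultimately show "i \<in> {1..n} \<and> A \<subseteq> {1..n}" by auto
next
  assume "i \<in> {1..n} \<and> A \<subseteq> {1..n}"
  then show "cover_edge i A \<in> cover_edges n"
    using assms unfolding cover_edges_def by blast
qed

lemma finite_cover_edges: "finite (cover_edges n)"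
proof (rule finite_subset)
  show "cover_edges n \<subseteq> Pow {1..n} \<times> Pow {1..n}"
    by (auto simp: cover_edges_def cover_edge_def)
qed simp

lemma diamond_step_mono_power:
  assumes "t \<le> u"
  shows "(diamond_step n ^^ t) S \<subseteq> (diamond_step n ^^ u) S"
  by (rule lift_Suc_mono_le[OF _ assms]) (auto simp: diamond_step_def)

text \<open>A half has only two edges, so if the closure contains it then a single stage does.\<close>

lemma pair_in_diamond_closure:
  assumes "a \<in> diamond_closure n S" "b \<in> diamond_closure n S"
  obtains t where "{a, b} \<subseteq> (diamond_step n ^^ t) S"
proof -
  obtain t u where "a \<in> (diamond_step n ^^ t) S" "b \<in> (diamond_step n ^^ u) S"
    using assms by (auto simp: diamond_closure_def)
  then have "{a, b} \<subseteq> (diamond_step n ^^ max t u) S"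
    using diamond_step_mono_power[of t "max t u" n S] diamond_step_mono_power[of u "max t u" n S]
    by auto
  then show ?thesis by (rule that)
qed

lemma half_in_diamond_closure:
  assumes "is_diamond n A i j"
    and "lower_half A i j \<subseteq> diamond_closure n S \<or> upper_half A i j \<subseteq> diamond_closure n S"
  shows "lower_half A i j \<union> upper_half A i j \<subseteq> diamond_closure n S"
proof -
  obtain t where t: "lower_half A i j \<subseteq> (diamond_step n ^^ t) S
      \<or> upper_half A i j \<subseteq> (diamond_step n ^^ t) S"
    using assms(2) unfolding lower_half_def upper_half_def
    by (metis insert_subset pair_in_diamond_closure)
  have "lower_half A i j \<union> upper_half A i j \<subseteq> diamond_step n ((diamond_step n ^^ t) S)"
    using assms(1) t unfolding diamond_step_def by blast
  also have "\<dots> = (diamond_step n ^^ Suc t) S"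
    by simp
  also have "\<dots> \<subseteq> diamond_closure n S"
    unfolding diamond_closure_def by blast
  finally show ?thesis .
qed

lemma diamond_closed_closure: "diamond_closed n (\<lambda>i A. cover_edge i A \<in> diamond_closure n S)"
  unfolding diamond_closed_def
proof (intro allI impI)
  fix A i j assume "is_diamond n A i j"
  from half_in_diamond_closure[OF this, of S]
  show "cover_edge i A \<in> diamond_closure n S \<and> cover_edge j A \<in> diamond_closure n S \<longleftrightarrow>
      cover_edge i (insert j A) \<in> diamond_closure n S \<and> cover_edge j (insert i A) \<in> diamond_closure n S"
    by (auto simp: lower_half_def upper_half_def)
qed

lemma subset_diamond_closure: "S \<subseteq> diamond_closure n S"
proof -
  have "(diamond_step n ^^ 0) S \<subseteq> diamond_closure n S"
    unfolding diamond_closure_def by blast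
  then show ?thesis by simp
qed

lemma diamond_closure_least:
  assumes "S \<subseteq> T" and "diamond_step n T \<subseteq> T"
  shows "diamond_closure n S \<subseteq> T"
proof -
  have mono: "diamond_step n U \<subseteq> diamond_step n T" if "U \<subseteq> T" for U
    using that unfolding diamond_step_def by blast
  have "(diamond_step n ^^ t) S \<subseteq> T" for t
  proof (induction t)
    case (Suc t)
    from mono[OF this] assms(2) show ?case by simp
  qed (simp add: assms(1))
  then show ?thesis by (auto simp: diamond_closure_def)
qed

text \<open>
  The induction principle behind all negative results: what holds on a generating set and
  survives diamonds holds on every cover edge. A set is shown not to generate by a
  diamond-closed predicate that holds on the set but fails somewhere.
\<close>

lemma generating_induct:
  assumes gen: "diamond_generating n S"
    and closed: "diamond_closed n R"
    and base: "\<And>i A. cover_edge i A \<in> S \<Longrightarrow> i \<in> {1..n} \<Longrightarrow> A \<subseteq> {1..n} - {i} \<Longrightarrow> R i A"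
    and "i \<in> {1..n}" "A \<subseteq> {1..n} - {i}"
  shows "R i A"
proof -
  define T where "T = {cover_edge i A | i A. i \<in> {1..n} \<and> A \<subseteq> {1..n} - {i} \<and> R i A}"
  have T: "cover_edge i A \<in> T \<longleftrightarrow> i \<in> {1..n} \<and> A \<subseteq> {1..n} - {i} \<and> R i A" if "i \<notin> A" for i A
  proof
    assume "cover_edge i A \<in> T"
    then obtain j B where "cover_edge i A = cover_edge j B" "j \<in> {1..n}" "B \<subseteq> {1..n} - {j}" "R j B"
      by (auto simp: T_def)
    moreover from this have "i = j \<and> A = B"
      using that cover_edge_inject[of i A j B] by auto
    ultimately show "i \<in> {1..n} \<and> A \<subseteq> {1..n} - {i} \<and> R i A" by auto
  qed (auto simp: T_def)
  have "S \<subseteq> T"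
  proof
    fix e assume "e \<in> S"
    moreover from this obtain i A where "e = cover_edge i A" "i \<in> {1..n}" "A \<subseteq> {1..n} - {i}"
      using gen by (auto simp: diamond_generating_def cover_edges_def)
    ultimately show "e \<in> T" using base T_def by blast
  qed
  moreover have "diamond_step n T \<subseteq> T"
  proof -
    have "lower_half A i j \<union> upper_half A i j \<subseteq> T"
      if d: "is_diamond n A i j" and half: "lower_half A i j \<subseteq> T \<or> upper_half A i j \<subseteq> T" for A i j
    proof -
      from d have d': "A \<subseteq> {1..n}" "i \<in> {1..n}" "j \<in> {1..n}" "i \<notin> A" "j \<notin> A" "i \<noteq> j"
        by (auto simp: is_diamond_def)
      have "R i A \<and> R j A \<longleftrightarrow> R i (insert j A) \<and> R j (insert i A)"
        by (rule diamond_closedD[OF closed d'])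
      then show ?thesis
        using half d' by (auto simp: lower_half_def upper_half_def T)
    qed
    then show ?thesis unfolding diamond_step_def by blast
  qed
  ultimately have "diamond_closure n S \<subseteq> T"
    by (rule diamond_closure_least)
  moreover have "cover_edge i A \<in> diamond_closure n S"
    using assms(4,5) gen cover_edge_in_cover_edges[of i A n] by (auto simp: diamond_generating_def)
  ultimately show ?thesis
    using T assms(5) by blast
qed

section \<open>Cographs generate\<close>

text \<open>
  Every \<open>A \<union> C\<close> is reached from \<open>C\<close> by adding the elements of \<open>A\<close> one at a time, each
  addition being a step from the lower to the upper half of a diamond.
\<close>

lemma diamond_closed_from_bottom:
  assumes closed: "diamond_closed n R"
    and sub: "V \<subseteq> {1..n}" "C \<subseteq> {1..n} - V"
    and bottom: "\<And>i. i \<in> V \<Longrightarrow> R i C"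
    and "i \<in> V" "A \<subseteq> V - {i}"
  shows "R i (A \<union> C)"
proof -
  have "finite A" using assms(6) sub(1) by (meson finite_Diff finite_atLeastAtMost finite_subset)
  then show ?thesis using assms(5,6)
  proof (induction A arbitrary: i rule: finite_induct)
    case empty
    then show ?case using bottom by simp
  next
    case (insert j B)
    then have "R i (B \<union> C)" "R j (B \<union> C)" by blast+
    then have "R i (insert j (B \<union> C))"
      using diamond_closedD[OF closed, of "B \<union> C" i j] insert.hyps insert.prems sub by blast
    then show ?case by simp
  qed
qed

text \<open>
  The dual statement. The induction runs over the set \<open>D\<close> of elements that \<open>A\<close> lacks in
  \<open>V - {i}\<close>, with steps from upper to lower halves.
\<close>

lemma diamond_closed_from_top:
  assumes closed: "diamond_closed n R"
    and sub: "V \<subseteq> {1..n}" "C \<subseteq> {1..n} - V"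
    and top: "\<And>i. i \<in> V \<Longrightarrow> R i (V - {i} \<union> C)"
    and "i \<in> V" "A \<subseteq> V - {i}"
  shows "R i (A \<union> C)"
proof -
  define D where "D = V - {i} - A"
  have "finite D" using sub(1) finite_subset[of D "{1..n}"] by (auto simp: D_def)
  moreover have "D \<subseteq> V - {i}" by (auto simp: D_def)
  ultimately have "R i (V - {i} - D \<union> C)" using assms(5)
  proof (induction D arbitrary: i rule: finite_induct)
    case empty
    then show ?case using top by simp
  next
    case (insert j B)
    define A where "A = V - {i} - insert j B \<union> C"
    have "V - {i} - B \<union> C = insert j A" "V - {j} - B \<union> C = insert i A"
      using insert.hyps insert.prems by (auto simp: A_def)
    moreover have "R i (V - {i} - B \<union> C)" "R j (V - {j} - B \<union> C)"
      using insert by blast+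
    ultimately have "R i (insert j A)" "R j (insert i A)" by simp_all
    moreover have "A \<subseteq> {1..n}" "i \<in> {1..n}" "j \<in> {1..n}" "i \<notin> A" "j \<notin> A" "i \<noteq> j"
      using insert.hyps insert.prems sub by (auto simp: A_def)
    ultimately have "R i A"
      using diamond_closedD[OF closed, of A i j] by blast
    then show ?case by (simp add: A_def)
  qed
  moreover have "V - {i} - D = A" using assms(6) by (auto simp: D_def)
  ultimately show ?thesis by simp
qed

lemma nbhd_subset_pverts:
  assumes "cograph G"
  shows "nbhd G i \<subseteq> pverts G - {i}"
proof -
  interpret pair_graph G by (rule cograph_imp_pair_graph[OF assms])
  show ?thesis by (auto simp: nbhd_def dest: wellformed' pair_no_loops)
qed

lemma nbhd_outside_pverts:
  assumes "cograph G" "i \<notin> pverts G"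
  shows "nbhd G i = {}"
proof -
  interpret pair_graph G by (rule cograph_imp_pair_graph[OF assms(1)])
  show ?thesis using assms(2) by (auto simp: nbhd_def dest: wellformed')
qed

text \<open>
  The shift \<open>C\<close> is what makes the induction work at a join, where the neighborhoods in one part
  contain the whole other part.
\<close>

lemma cograph_generates_cube:
  assumes "cograph G" "diamond_closed n R"
    and "pverts G \<subseteq> {1..n}" "C \<subseteq> {1..n} - pverts G"
    and "\<And>i. i \<in> pverts G \<Longrightarrow> R i (nbhd G i \<union> C)"
    and "i \<in> pverts G" "A \<subseteq> pverts G - {i}"
  shows "R i (A \<union> C)"
  using assms
proof (induction arbitrary: C i A rule: cograph.induct)
  case (single v)
  then show ?case by (auto simp: nbhd_def)
next
  case (union G H)
  let ?K = "graph_union G H"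
  have V: "pverts ?K = pverts G \<union> pverts H" by (simp add: graph_union_def)
  have NG: "nbhd ?K k = nbhd G k" if "k \<in> pverts G" for k
    using that union.hyps(3) nbhd_outside_pverts[OF \<open>cograph H\<close>, of k]
    by (auto simp: graph_union_def nbhd_def)
  have NH: "nbhd ?K k = nbhd H k" if "k \<in> pverts H" for k
    using that union.hyps(3) nbhd_outside_pverts[OF \<open>cograph G\<close>, of k]
    by (auto simp: graph_union_def nbhd_def)
  have "R k C" if "k \<in> pverts ?K" for k
  proof -
    from that consider "k \<in> pverts G" | "k \<in> pverts H" by (auto simp: V)
    then show ?thesis
    proof cases
      case 1
      have "R l (nbhd G l \<union> C)" if "l \<in> pverts G" for l
        using union.prems(4)[of l] that by (simp add: NG V)
      then show ?thesis
        using union.IH(1)[of C k "{}"] union.prems(1,2,3) 1 by (auto simp: V)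
    next
      case 2
      have "R l (nbhd H l \<union> C)" if "l \<in> pverts H" for l
        using union.prems(4)[of l] that by (simp add: NH V)
      then show ?thesis
        using union.IH(2)[of C k "{}"] union.prems(1,2,3) 2 by (auto simp: V)
    qed
  qed
  then show ?case
    using diamond_closed_from_bottom[of n R "pverts ?K" C i A] union.prems by blast
next
  case (join G H)
  let ?K = "graph_join G H"
  have V: "pverts ?K = pverts G \<union> pverts H" by (simp add: graph_join_def)
  have NG: "nbhd ?K k = nbhd G k \<union> pverts H" if "k \<in> pverts G" for k
    using that join.hyps(3) nbhd_outside_pverts[OF \<open>cograph H\<close>, of k]
    by (auto simp: graph_join_def nbhd_def)
  have NH: "nbhd ?K k = nbhd H k \<union> pverts G" if "k \<in> pverts H" for k
    using that join.hyps(3) nbhd_outside_pverts[OF \<open>cograph G\<close>, of k]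
    by (auto simp: graph_join_def nbhd_def)
  have "R k (pverts ?K - {k} \<union> C)" if "k \<in> pverts ?K" for k
  proof -
    from that consider "k \<in> pverts G" | "k \<in> pverts H" by (auto simp: V)
    then show ?thesis
    proof cases
      case 1
      have "R l (nbhd G l \<union> (pverts H \<union> C))" if "l \<in> pverts G" for l
        using join.prems(4)[of l] that by (simp add: NG V Un_assoc)
      then have "R k (pverts G - {k} \<union> (pverts H \<union> C))"
        using join.IH(1)[of "pverts H \<union> C" k "pverts G - {k}"] join.prems(1,2,3) join.hyps(3) 1
        unfolding V by blast
      moreover have "pverts ?K - {k} \<union> C = pverts G - {k} \<union> (pverts H \<union> C)"
        using 1 join.hyps(3) by (auto simp: V)
      ultimately show ?thesis by simp
    next
      case 2
      have "R l (nbhd H l \<union> (pverts G \<union> C))" if "l \<in> pverts H" for l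
        using join.prems(4)[of l] that by (simp add: NH V Un_assoc)
      then have "R k (pverts H - {k} \<union> (pverts G \<union> C))"
        using join.IH(2)[of "pverts G \<union> C" k "pverts H - {k}"] join.prems(1,2,3) join.hyps(3) 2
        unfolding V by blast
      moreover have "pverts ?K - {k} \<union> C = pverts H - {k} \<union> (pverts G \<union> C)"
        using 2 join.hyps(3) by (auto simp: V)
      ultimately show ?thesis by simp
    qed
  qed
  then show ?case
    using diamond_closed_from_top[of n R "pverts ?K" C i A] join.prems by blast
qed

lemma cograph_generating:
  assumes "cograph G" "pverts G = {1..n}"
  shows "diamond_generating n (graph_edges G)"
proof -
  let ?R = "\<lambda>i A. cover_edge i A \<in> diamond_closure n (graph_edges G)"
  have "?R i (nbhd G i \<union> {})" if "i \<in> pverts G" for i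
    using that subset_diamond_closure[of "graph_edges G" n] by (auto simp: graph_edges_def)
  then have "?R i (A \<union> {})" if "i \<in> {1..n}" "A \<subseteq> {1..n} - {i}" for i A
    using cograph_generates_cube[OF assms(1) diamond_closed_closure, of n "{}" "graph_edges G" i A]
      assms(2) that by auto
  then have "cover_edges n \<subseteq> diamond_closure n (graph_edges G)"
    by (auto simp: cover_edges_def)
  moreover have sub: "graph_edges G \<subseteq> cover_edges n"
    using nbhd_subset_pverts[OF assms(1)] assms(2) unfolding graph_edges_def cover_edges_def by blast
  moreover have "diamond_closure n (graph_edges G) \<subseteq> cover_edges n"
    using sub
    by (rule diamond_closure_least)
      (fastforce simp: diamond_step_def is_diamond_def lower_half_def upper_half_def
        cover_edge_in_cover_edges)
  ultimately show ?thesis by (auto simp: diamond_generating_def)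
qed

lemma card_graph_edges:
  assumes "cograph G" "pverts G = {1..n}"
  shows "card (graph_edges G) = n"
proof -
  have "inj_on (\<lambda>i. cover_edge i (nbhd G i)) {1..n}"
    using nbhd_subset_pverts[OF assms(1)]
    by (intro inj_onI) (subst (asm) cover_edge_inject; blast)
  moreover have "graph_edges G = (\<lambda>i. cover_edge i (nbhd G i)) ` {1..n}"
    using assms(2) by (auto simp: graph_edges_def)
  ultimately show ?thesis by (simp add: card_image)
qed

section \<open>The minimum size\<close>

text \<open>Having a direction other than \<open>i\<close> is diamond-closed, and it fails at \<open>e\<^sub>i(\<emptyset>)\<close>.\<close>

lemma generating_has_direction:
  assumes "diamond_generating n S" "i \<in> {1..n}"
  obtains A where "A \<subseteq> {1..n} - {i}" "cover_edge i A \<in> S"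
proof (rule ccontr)
  assume no: "\<not> thesis"
  have "diamond_closed n (\<lambda>j _. j \<noteq> i)" by (auto simp: diamond_closed_def)
  from generating_induct[OF assms(1) this _ assms(2), of "{}"] no that show False by blast
qed

text \<open>
  A choice of edges \<open>e\<^sub>i(f i)\<close> from \<open>S\<close> gives \<open>n\<close> different elements, hence both the lower
  bound on the size of \<open>S\<close> and the shape of \<open>S\<close> in the case of equality.
\<close>

lemma generating_choice:
  assumes "diamond_generating n S"
  obtains f where "\<And>i. i \<in> {1..n} \<Longrightarrow> f i \<subseteq> {1..n} - {i}"
    "(\<lambda>i. cover_edge i (f i)) ` {1..n} \<subseteq> S"
    "card ((\<lambda>i. cover_edge i (f i)) ` {1..n}) = n"
proof -
  have "\<forall>i\<in>{1..n}. \<exists>A. A \<subseteq> {1..n} - {i} \<and> cover_edge i A \<in> S"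
    using generating_has_direction[OF assms] by metis
  then obtain f where f: "\<forall>i\<in>{1..n}. f i \<subseteq> {1..n} - {i} \<and> cover_edge i (f i) \<in> S"
    by metis
  then have "inj_on (\<lambda>i. cover_edge i (f i)) {1..n}"
    by (intro inj_onI) (subst (asm) cover_edge_inject; blast)
  then show ?thesis using f that[of f] by (auto simp: card_image)
qed

lemma card_generating_ge:
  assumes "diamond_generating n S"
  shows "n \<le> card S"
proof -
  have "finite S"
    using assms finite_cover_edges finite_subset by (auto simp: diamond_generating_def)
  then show ?thesis using generating_choice[OF assms] card_mono by metis
qed

text \<open>The lower bound is attained because edgeless graphs are cographs.\<close>

lemma cograph_edgeless:
  assumes "finite V" "V \<noteq> {}"
  shows "cograph \<lparr>pverts = V, parcs = {}\<rparr>"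
  using assms
proof (induction rule: finite_ne_induct)
  case (insert v V)
  have "graph_union \<lparr>pverts = {v}, parcs = {}\<rparr> \<lparr>pverts = V, parcs = {}\<rparr>
      = \<lparr>pverts = insert v V, parcs = {}\<rparr>"
    by (simp add: graph_union_def)
  then show ?case using cograph.union[OF cograph.single insert.IH, of v] insert.hyps by simp
qed (rule cograph.single)

lemma min_diamond_generating_iff:
  assumes "n \<ge> 1"
  shows "S \<in> min_diamond_generating n \<longleftrightarrow> diamond_generating n S \<and> card S = n"
proof -
  let ?G = "\<lparr>pverts = {1..n}, parcs = {}\<rparr> :: nat pair_pre_digraph"
  have "cograph ?G" using assms by (intro cograph_edgeless) auto
  then have "diamond_generating n (graph_edges ?G)" "card (graph_edges ?G) = n"
    using cograph_generating card_graph_edges by simp_all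
  then show ?thesis
    using card_generating_ge unfolding min_diamond_generating_def is_arg_min_def mem_Collect_eq
    by (metis le_antisym not_less)
qed

section \<open>Generating sets with one edge per direction come from cographs\<close>

text \<open>
  Suppose that \<open>j \<in> f i\<close> but \<open>i \<notin> f j\<close>. The predicate below keeps, in the projection to the
  coordinates \<open>i\<close> and \<open>j\<close>, an upper edge of direction \<open>i\<close> and a lower edge of direction \<open>j\<close>.
  These two edges of a single diamond form neither of its halves, so the predicate is
  diamond-closed; but it fails at \<open>e\<^sub>i(\<emptyset>)\<close>.
\<close>

lemma generating_symmetric:
  assumes gen: "diamond_generating n ((\<lambda>i. cover_edge i (f i)) ` {1..n})"
    and f: "\<And>i. i \<in> {1..n} \<Longrightarrow> f i \<subseteq> {1..n} - {i}"
    and ij: "i \<in> {1..n}" "j \<in> {1..n}" "j \<in> f i"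
  shows "i \<in> f j"
proof (rule ccontr)
  assume "i \<notin> f j"
  let ?R = "\<lambda>k A. (k = i \<longrightarrow> j \<in> A) \<and> (k = j \<longrightarrow> i \<notin> A)"
  have "i \<noteq> j" using f ij by blast
  then have closed: "diamond_closed n ?R"
    by (auto simp: diamond_closed_def is_diamond_def)
  have base: "?R k A" if k: "cover_edge k A \<in> (\<lambda>i. cover_edge i (f i)) ` {1..n}" "A \<subseteq> {1..n} - {k}"
    for k A
  proof -
    obtain l where "l \<in> {1..n}" "cover_edge k A = cover_edge l (f l)" using k by blast
    then have "A = f k" using f[of l] k(2) cover_edge_inject[of k A l "f l"] by blast
    then show ?thesis using ij(3) \<open>i \<notin> f j\<close> by auto
  qed
  from generating_induct[OF gen closed base ij(1), of "{}"] show False by simp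
qed

definition induced_graph :: "(nat \<Rightarrow> nat set) \<Rightarrow> nat set \<Rightarrow> nat pair_pre_digraph" where
  "induced_graph f V = \<lparr>pverts = V, parcs = {(i, j). i \<in> V \<and> j \<in> V \<and> j \<in> f i}\<rparr>"

definition is_module :: "(nat \<Rightarrow> nat set) \<Rightarrow> nat set \<Rightarrow> bool" where
  "is_module f V \<longleftrightarrow> (\<forall>i\<in>V. \<forall>j\<in>V. f i - V = f j - V)"

lemma is_moduleD:
  assumes "is_module f V" "i \<in> V" "j \<in> V" "k \<notin> V"
  shows "k \<in> f i \<longleftrightarrow> k \<in> f j"
  using assms unfolding is_module_def by blast

lemma induced_graph_union:
  assumes "\<And>i j. i \<in> V \<Longrightarrow> j \<in> W \<Longrightarrow> j \<notin> f i \<and> i \<notin> f j"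
  shows "graph_union (induced_graph f V) (induced_graph f W) = induced_graph f (V \<union> W)"
  using assms by (auto simp: graph_union_def induced_graph_def)

lemma induced_graph_join:
  assumes "\<And>i j. i \<in> V \<Longrightarrow> j \<in> W \<Longrightarrow> j \<in> f i \<and> i \<in> f j"
  shows "graph_join (induced_graph f V) (induced_graph f W) = induced_graph f (V \<union> W)"
  using assms by (auto simp: graph_join_def induced_graph_def)

lemma is_module_Un:
  assumes "is_module f V" "is_module f W" "i \<in> V" "j \<in> W"
    and "f i - (V \<union> W) = f j - (V \<union> W)"
  shows "is_module f (V \<union> W)"
proof -
  have "f k - (V \<union> W) = f i - (V \<union> W)" if "k \<in> V \<union> W" for k
  proof (cases "k \<in> V")
    case True
    then have "f k - V = f i - V" using assms(1,3) unfolding is_module_def by blast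
    then show ?thesis by blast
  next
    case False
    then have "f k - W = f j - W" using that assms(2,4) unfolding is_module_def by blast
    then show ?thesis using assms(5) by blast
  qed
  then show ?thesis unfolding is_module_def by blast
qed

text \<open>
  Two disjoint modules of a graph are completely adjacent or completely nonadjacent. So as soon as their
  neighborhoods elsewhere agree, which need only be tested at one vertex of each, their union is
  a module and induces their graph join or their disjoint union.
\<close>

lemma merge_cograph_modules:
  assumes sym: "\<And>i j. i \<in> V \<union> W \<Longrightarrow> j \<in> V \<union> W \<Longrightarrow> j \<in> f i \<longleftrightarrow> i \<in> f j"
    and V: "is_module f V" "cograph (induced_graph f V)" "i \<in> V"
    and W: "is_module f W" "cograph (induced_graph f W)" "j \<in> W"
    and disj: "V \<inter> W = {}"
    and outside: "f i - (V \<union> W) = f j - (V \<union> W)"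
  shows "is_module f (V \<union> W)" "cograph (induced_graph f (V \<union> W))"
proof -
  show "is_module f (V \<union> W)"
    by (rule is_module_Un[OF V(1) W(1) V(3) W(3) outside])
  have const: "w \<in> f v \<longleftrightarrow> j \<in> f i" if "v \<in> V" "w \<in> W" for v w
  proof -
    have "w \<in> f v \<longleftrightarrow> w \<in> f i" using is_moduleD[OF V(1), of v i w] that V(3) disj by blast
    also have "\<dots> \<longleftrightarrow> i \<in> f w" using sym[of i w] that V(3) by blast
    also have "\<dots> \<longleftrightarrow> i \<in> f j" using is_moduleD[OF W(1), of w j i] that V(3) W(3) disj by blast
    also have "\<dots> \<longleftrightarrow> j \<in> f i" using sym[of i j] V(3) W(3) by blast
    finally show ?thesis .
  qed
  have pv: "pverts (induced_graph f V) \<inter> pverts (induced_graph f W) = {}"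
    using disj by (simp add: induced_graph_def)
  show "cograph (induced_graph f (V \<union> W))"
  proof (cases "j \<in> f i")
    case True
    then have adj: "w \<in> f v \<and> v \<in> f w" if "v \<in> V" "w \<in> W" for v w
      using const that sym[of v w] by blast
    from cograph.join[OF V(2) W(2) pv] show ?thesis
      using induced_graph_join[OF adj] by simp
  next
    case False
    then have adj: "w \<notin> f v \<and> v \<notin> f w" if "v \<in> V" "w \<in> W" for v w
      using const that sym[of v w] by blast
    from cograph.union[OF V(2) W(2) pv] show ?thesis
      using induced_graph_union[OF adj] by simp
  qed
qed

text \<open>
  The predicate \<open>R\<close> of the proof describes the subcubes of all modules of the partition \<open>P\<close>. It
  holds at every \<open>e\<^sub>i(f i)\<close>. If it were diamond-closed it would hold everywhere, which is absurd:
  for \<open>i\<close> and \<open>j\<close> in different modules it cannot hold at both \<open>e\<^sub>i(\<emptyset>)\<close> and \<open>e\<^sub>i({j})\<close>. A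
  violating diamond yields the two modules to merge; its directions lie in different modules,
  since inside the subcube of a single module the two halves stand or fall together.
\<close>

lemma cograph_partition_mergeable:
  assumes gen: "diamond_generating n ((\<lambda>i. cover_edge i (f i)) ` {1..n})"
    and f: "\<And>i. i \<in> {1..n} \<Longrightarrow> f i \<subseteq> {1..n} - {i}"
    and P: "partition_on {1..n} P"
    and mods: "\<And>V. V \<in> P \<Longrightarrow> is_module f V \<and> cograph (induced_graph f V)"
    and two: "V0 \<in> P" "W0 \<in> P" "V0 \<noteq> W0"
  obtains V W where "V \<in> P" "W \<in> P" "V \<noteq> W"
    "is_module f (V \<union> W)" "cograph (induced_graph f (V \<union> W))"
proof -
  have sub: "V \<subseteq> {1..n}" if "V \<in> P" for V using P that by (auto simp: partition_on_def)
  have disj: "V = W" if "V \<in> P" "W \<in> P" "k \<in> V" "k \<in> W" for V W k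
    using partition_onD2[OF P] that by (auto simp: disjoint_def)
  have ex: "\<exists>V\<in>P. k \<in> V" if "k \<in> {1..n}" for k using partition_onD1[OF P] that by blast
  define R where "R i A \<longleftrightarrow> (\<exists>V\<in>P. i \<in> V \<and> A - V = f i - V)" for i A
  have R_iff: "R i A \<longleftrightarrow> A - V = f i - V" if "V \<in> P" "i \<in> V" for V i A
    using that disj unfolding R_def by blast
  have "\<not> diamond_closed n R"
  proof
    assume closed: "diamond_closed n R"
    have base: "R k A" if k: "cover_edge k A \<in> (\<lambda>i. cover_edge i (f i)) ` {1..n}" "k \<in> {1..n}"
      "A \<subseteq> {1..n} - {k}" for k A
    proof -
      obtain l where "l \<in> {1..n}" "cover_edge k A = cover_edge l (f l)" using k by blast
      then have "A = f k" using f[of l] k(3) cover_edge_inject[of k A l "f l"] by blast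
      then show ?thesis using ex k(2) unfolding R_def by blast
    qed
    obtain i j where ij: "i \<in> V0" "j \<in> W0"
      using two partition_onD3[OF P] by (metis ex_in_conv)
    then have "j \<notin> V0" using disj two by blast
    moreover have "i \<in> {1..n}" "j \<in> {1..n}" using ij two sub by blast+
    ultimately have "R i {}" "R i {j}"
      using generating_induct[OF gen closed base, of i "{}"]
        generating_induct[OF gen closed base, of i "{j}"] ij by blast+
    then show False using R_iff[OF two(1) ij(1)] \<open>j \<notin> V0\<close> by blast
  qed
  then obtain A i j where d: "is_diamond n A i j"
    and viol: "\<not> (R i A \<and> R j A \<longleftrightarrow> R i (insert j A) \<and> R j (insert i A))"
    unfolding diamond_closed_def by blast
  from d have d': "i \<in> {1..n}" "j \<in> {1..n}"
    by (auto simp: is_diamond_def)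
  obtain V W where VW: "V \<in> P" "i \<in> V" "W \<in> P" "j \<in> W" using ex d' by metis
  have viol': "\<not> (A - V = f i - V \<and> A - W = f j - W \<longleftrightarrow>
      insert j A - V = f i - V \<and> insert i A - W = f j - W)"
    using viol unfolding R_iff[OF VW(1,2)] R_iff[OF VW(3,4)] .
  have ne: "V \<noteq> W"
  proof
    assume "V = W"
    then have "insert j A - V = A - V" "insert i A - W = A - W" using VW by auto
    then show False using viol' by simp
  qed
  have sym: "l \<in> f k \<longleftrightarrow> k \<in> f l" if "k \<in> V \<union> W" "l \<in> V \<union> W" for k l
  proof -
    have "k \<in> {1..n}" "l \<in> {1..n}" using that sub VW by blast+
    then show ?thesis using generating_symmetric[OF gen f] by blast
  qed
  have "V \<inter> W = {}" using disj VW ne by blast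
  moreover
  have half: "A - V = f i - V \<and> A - W = f j - W
      \<or> insert j A - V = f i - V \<and> insert i A - W = f j - W"
    using viol' by argo
  \<comment> \<open>Outside \<open>V \<union> W\<close> the lower ends of the two edges of the half agree with \<open>A\<close>.\<close>
  have outside: "k \<in> f i \<longleftrightarrow> k \<in> f j" if "k \<notin> V \<union> W" for k
  proof -
    show ?thesis using half
    proof
      assume "A - V = f i - V \<and> A - W = f j - W"
      then have "k \<in> A - V \<longleftrightarrow> k \<in> f i - V" "k \<in> A - W \<longleftrightarrow> k \<in> f j - W"
        by (simp_all only:)
      then show ?thesis using that by simp
    next
      assume "insert j A - V = f i - V \<and> insert i A - W = f j - W"
      then have "k \<in> insert j A - V \<longleftrightarrow> k \<in> f i - V" "k \<in> insert i A - W \<longleftrightarrow> k \<in> f j - W"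
        by (simp_all only:)
      moreover have "k \<noteq> i" "k \<noteq> j" using that VW(2) VW(4) by blast+
      ultimately show ?thesis using that by simp
    qed
  qed
  have "f i - (V \<union> W) = f j - (V \<union> W)" using outside by auto
  moreover have "is_module f V" "cograph (induced_graph f V)"
    "is_module f W" "cograph (induced_graph f W)"
    using mods VW by simp_all
  ultimately have "is_module f (V \<union> W)" "cograph (induced_graph f (V \<union> W))"
    using merge_cograph_modules[OF sym _ _ VW(2) _ _ VW(4)] by simp_all
  then show ?thesis by (rule that[OF VW(1,3) ne])
qed

lemma partition_on_merge:
  assumes P: "partition_on X P" and V: "V \<in> P" and W: "W \<in> P"
  shows "partition_on X (insert (V \<union> W) (P - {V, W}))"
proof (rule partition_onI)
  show "\<Union> (insert (V \<union> W) (P - {V, W})) = X"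
    using partition_onD1[OF P] V W by blast
  show "{} \<notin> insert (V \<union> W) (P - {V, W})"
    using partition_onD3[OF P] V by auto
  have P_disjnt: "disjnt p q" if "p \<in> P" "q \<in> P" "p \<noteq> q" for p q
    using partition_onD2[OF P] that by (auto simp: disjoint_def disjnt_def)
  have "disjnt (V \<union> W) q" if "q \<in> P - {V, W}" for q
    using P_disjnt[of V q] P_disjnt[of W q] V W that by (auto simp: disjnt_Un1)
  then show "disjnt p q" if "p \<in> insert (V \<union> W) (P - {V, W})"
    "q \<in> insert (V \<union> W) (P - {V, W})" "p \<noteq> q" for p q
    using that P_disjnt disjnt_sym by blast
qed

text \<open>
  The singletons form a partition into cograph modules. By mergeability, one with the fewest
  parts has a single part.
\<close>

lemma generating_imp_cograph:
  assumes n: "n \<ge> 1"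
    and gen: "diamond_generating n ((\<lambda>i. cover_edge i (f i)) ` {1..n})"
    and f: "\<And>i. i \<in> {1..n} \<Longrightarrow> f i \<subseteq> {1..n} - {i}"
  shows "cograph (induced_graph f {1..n})"
proof -
  define good where "good P \<longleftrightarrow> partition_on {1..n} P \<and>
    (\<forall>V\<in>P. is_module f V \<and> cograph (induced_graph f V))" for P
  have "good ((\<lambda>i. {i}) ` {1..n})"
  proof -
    have "induced_graph f {i} = \<lparr>pverts = {i}, parcs = {}\<rparr>" if "i \<in> {1..n}" for i
      using f[OF that] by (auto simp: induced_graph_def)
    then have "cograph (induced_graph f {i})" if "i \<in> {1..n}" for i
      using that cograph.single by simp
    moreover have "partition_on {1..n} ((\<lambda>i. {i}) ` {1..n})"
      by (rule partition_onI) (auto simp: disjnt_def)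
    ultimately show ?thesis by (auto simp: good_def is_module_def)
  qed
  then obtain P where P: "good P" and least: "\<And>Q. good Q \<Longrightarrow> card P \<le> card Q"
    using ex_has_least_nat[of good _ card] by blast
  have part: "partition_on {1..n} P" using P by (simp add: good_def)
  then have fin: "finite P" by (rule finite_elements[rotated]) simp
  have single: "V = W" if VW: "V \<in> P" "W \<in> P" for V W
  proof (rule ccontr)
    assume "V \<noteq> W"
    obtain V' W' where m: "V' \<in> P" "W' \<in> P" "V' \<noteq> W'"
      "is_module f (V' \<union> W')" "cograph (induced_graph f (V' \<union> W'))"
      by (rule cograph_partition_mergeable[OF gen f part _ VW \<open>V \<noteq> W\<close>])
        (use P in \<open>auto simp: good_def\<close>)
    let ?Q = "insert (V' \<union> W') (P - {V', W'})"
    have "good ?Q"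
      using P m partition_on_merge[OF part m(1,2)] unfolding good_def by blast
    moreover have "card ?Q < card P"
    proof -
      have "card {V', W'} \<le> card P" using m fin by (intro card_mono) auto
      moreover have "card (P - {V', W'}) = card P - 2"
        using m fin by (subst card_Diff_subset) auto
      moreover have "card ?Q \<le> Suc (card (P - {V', W'}))" using fin by (simp add: card_insert_if)
      ultimately show ?thesis using m(3) by simp
    qed
    ultimately show False using least[of ?Q] by simp
  qed
  have "{1..n} \<in> P"
  proof -
    obtain V where "V \<in> P" using partition_onD1[OF part] n by fastforce
    moreover from this have "P = {V}" using single by blast
    ultimately show ?thesis using partition_onD1[OF part] by simp
  qed
  then show ?thesis using P by (simp add: good_def)
qed

section \<open>The bijection\<close>

lemma inj_on_graph_edges: "inj_on graph_edges (labeled_cographs n)"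
proof (rule inj_onI)
  fix G H assume GH: "G \<in> labeled_cographs n" "H \<in> labeled_cographs n"
    "graph_edges G = graph_edges H"
  then have cog: "cograph G" "cograph H" and pv: "pverts G = {1..n}" "pverts H = {1..n}"
    unfolding labeled_cographs_def by blast+
  have nb: "nbhd G i = nbhd H i" for i
  proof (cases "i \<in> {1..n}")
    case True
    then have "cover_edge i (nbhd G i) \<in> graph_edges H"
      using GH(3) pv by (auto simp: graph_edges_def)
    then obtain j where "cover_edge i (nbhd G i) = cover_edge j (nbhd H j)"
      by (auto simp: graph_edges_def)
    then show ?thesis
      using cover_edge_inject[of i "nbhd G i" j "nbhd H j"]
        nbhd_subset_pverts[OF cog(1), of i] nbhd_subset_pverts[OF cog(2), of j] by blast
  next
    case False
    then show ?thesis using nbhd_outside_pverts[OF cog(1)] nbhd_outside_pverts[OF cog(2)] pv by simp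
  qed
  have "e \<in> parcs G \<longleftrightarrow> e \<in> parcs H" for e
    using nb[of "fst e"] by (cases e) (auto simp: nbhd_def)
  then show "G = H" using pv by (intro pair_pre_digraph.equality) auto
qed

lemma min_generating_from_cograph:
  assumes n: "n \<ge> 1" and S: "diamond_generating n S" "card S = n"
  shows "S \<in> graph_edges ` labeled_cographs n"
proof -
  obtain f where f: "\<And>i. i \<in> {1..n} \<Longrightarrow> f i \<subseteq> {1..n} - {i}"
    and sub: "(\<lambda>i. cover_edge i (f i)) ` {1..n} \<subseteq> S"
    and card: "card ((\<lambda>i. cover_edge i (f i)) ` {1..n}) = n"
    using generating_choice[OF S(1)] by blast
  have "finite S"
    using S(1) finite_cover_edges finite_subset by (auto simp: diamond_generating_def)
  then have eq: "(\<lambda>i. cover_edge i (f i)) ` {1..n} = S"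
    using sub card S(2) by (intro card_subset_eq) auto
  let ?G = "induced_graph f {1..n}"
  have "cograph ?G" using generating_imp_cograph[OF n _ f] S(1) eq by simp
  then have "?G \<in> labeled_cographs n"
    using cograph_imp_pair_graph by (auto simp: labeled_cographs_def induced_graph_def)
  moreover have pv: "pverts ?G = {1..n}" by (simp add: induced_graph_def)
  have "nbhd ?G i = f i" if "i \<in> {1..n}" for i
    using that f[OF that] by (auto simp: nbhd_def induced_graph_def)
  then have "graph_edges ?G = (\<lambda>i. cover_edge i (f i)) ` {1..n}"
    unfolding Setcompr_eq_image graph_edges_def pv by (intro image_cong) simp_all
  ultimately show ?thesis using eq by blast
qed

theorem corollary7p1:
  fixes n :: nat
  assumes "n \<ge> 1"
  shows "bij_betw graph_edges (labeled_cographs n) (min_diamond_generating n)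
    \<and> card (labeled_cographs n) = card (min_diamond_generating n)"
proof -
  have "graph_edges ` labeled_cographs n = min_diamond_generating n"
  proof
    show "graph_edges ` labeled_cographs n \<subseteq> min_diamond_generating n"
      using cograph_generating card_graph_edges min_diamond_generating_iff[OF assms]
      by (auto simp: labeled_cographs_def)
    show "min_diamond_generating n \<subseteq> graph_edges ` labeled_cographs n"
      using min_generating_from_cograph[OF assms] min_diamond_generating_iff[OF assms] by blast
  qed
  then have "bij_betw graph_edges (labeled_cographs n) (min_diamond_generating n)"
    using inj_on_graph_edges by (simp add: bij_betw_def)
  then show ?thesis using bij_betw_same_card by blast
qed

end
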